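(* Let $g(z)=\frac{az+b}{cz+d}$ be a hyperbolic Möbius map with $a,b,c,d\in\mathbb{C}$, $ad-bc=1$, $c\neq 0$, let $k>1$ be its multiplier at the repelling fixed point, fix $\delta$ with $0<\delta<\left(1-\frac1k\right)^2$, and let $\mathcal{R}_g(\infty)=h^{-1}(\mathcal{R}_f(1))$ be the corresponding avoided region (all defined in the context). Then there exist $\varepsilon_0>0$ and a function $H:(0,\varepsilon_0)\to(0,\infty)$ with $\lim_{\varepsilon\to 0}H(\varepsilon)=0$ such that the following holds. For every $\varepsilon\in(0,\varepsilon_0)$ and every complex valued sequence $\{a_i\}_{i\in\mathbb{N}_0}$ with $a_0\in\mathbb{C}\setminus\mathcal{R}_g(\infty)$ and $$|a_{i+1}-g(a_i)|\le\varepsilon\quad\text{for all } i\in\mathbb{N}_0,$$ there exists a complex valued sequence $\{b_i\}_{i\in\mathbb{N}_0}$ with $b_{i+1}=g(b_i)$ for all $i\in\mathbb{N}_0$ and $$|a_i-b_i|\le H(\varepsilon)\quad\text{for all } i\in\mathbb{N}_0.$$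
   Context: $\mathbb{N}_0=\{0,1,2,\dots\}$ and $\hat{\mathbb{C}}=\mathbb{C}\cup\{\infty\}$. A Möbius map $g(z)=\frac{az+b}{cz+d}$ with $ad-bc=1$ is hyperbolic if $a+d\in\mathbb{R}\setminus[-2,2]$. It acts on $\hat{\mathbb{C}}$ with $g(-d/c)=\infty$ and $g(\infty)=a/c$. The inequality $|a_{i+1}-g(a_i)|\le\varepsilon$ includes the requirement $g(a_i)\neq\infty$, i.e. $a_i\ne -d/c$. Such a $g$ (with $c\ne0$) has exactly two fixed points in $\mathbb{C}$: the attracting one $\alpha$ ($|g'(\alpha)|<1$) and the repelling one $\beta$ ($|g'(\beta)|>1$). Put $k=\frac{1}{(c\beta+d)^2}=g'(\beta)$, which is real and $>1$, and $h(z)=\frac{z-\beta}{z-\alpha}$ (a Möbius map of $\hat{\mathbb{C}}$). Then $f=h\circ g\circ h^{-1}$ is $f(w)=kw$. For $\delta>0$ and $t\ge1$ define $$\mathcal{R}_1^t=\left\{w\in\mathbb{C}: |w|\le\tfrac{t\delta}{k-1},\ \mathrm{Re}\,w\le0\right\},$$ $$\mathcal{R}_2^t=\left\{w\in\mathbb{C}: |\mathrm{Im}\,w|\le\tfrac{t\delta}{k-1},\ 0\le\mathrm{Re}\,w\le\tfrac1k\right\},$$ $$\mathcal{R}_3^t=\left\{w\in\mathbb{C}: \left|w-\tfrac1k\right|\le\tfrac{t\delta}{k-1},\ \mathrm{Re}\,w\ge\tfrac1k\right\}.$$ The avoided regions are $\mathcal{R}_f(1)=\mathcal{R}_1^k\cup\mathcal{R}_2^1\cup\mathcal{R}_3^1$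 (where the superscript $k$ means $t=k$) and $\mathcal{R}_g(\infty)=h^{-1}(\mathcal{R}_f(1))$. *)

theory Defs
  imports "HOL-Analysis.Analysis"
begin

text \<open>The extended plane is the one-point extension of the complex numbers;
  \<open>None\<close> is the point at infinity.\<close>

type_synonym riemann_sphere = "complex option"

definition moebius_fun :: "complex \<Rightarrow> complex \<Rightarrow> complex \<Rightarrow> complex \<Rightarrow> complex \<Rightarrow> complex" where
  "moebius_fun a b c d z = (a * z + b) / (c * z + d)"

text \<open>The action on the extended plane, meaningful whenever \<open>a * d - b * c \<noteq> 0\<close>.\<close>

definition moebius :: "complex \<Rightarrow> complex \<Rightarrow> complex \<Rightarrow> complex \<Rightarrow> riemann_sphere \<Rightarrow> riemann_sphere" where
  "moebius a b c d p =
     (case p of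
        None \<Rightarrow> if c = 0 then None else Some (a / c)
      | Some z \<Rightarrow> if c * z + d = 0 then None else Some (moebius_fun a b c d z))"

definition hyperbolic_moebius :: "complex \<Rightarrow> complex \<Rightarrow> complex \<Rightarrow> complex \<Rightarrow> bool" where
  "hyperbolic_moebius a b c d \<longleftrightarrow>
     a * d - b * c = 1 \<and> a + d \<in> \<real> - complex_of_real ` {-2..2}"

definition attracting_fixpoint :: "complex \<Rightarrow> complex \<Rightarrow> complex \<Rightarrow> complex \<Rightarrow> complex \<Rightarrow> bool" where
  "attracting_fixpoint a b c d z \<longleftrightarrow>
     moebius a b c d (Some z) = Some z \<and> cmod (deriv (moebius_fun a b c d) z) < 1"

definition repelling_fixpoint :: "complex \<Rightarrow> complex \<Rightarrow> complex \<Rightarrow> complex \<Rightarrow> complex \<Rightarrow> bool" where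
  "repelling_fixpoint a b c d z \<longleftrightarrow>
     moebius a b c d (Some z) = Some z \<and> cmod (deriv (moebius_fun a b c d) z) > 1"

definition region1 :: "real \<Rightarrow> real \<Rightarrow> real \<Rightarrow> complex set" where
  "region1 k \<delta> t = {w. cmod w \<le> t * \<delta> / (k - 1) \<and> Re w \<le> 0}"

definition region2 :: "real \<Rightarrow> real \<Rightarrow> real \<Rightarrow> complex set" where
  "region2 k \<delta> t = {w. \<bar>Im w\<bar> \<le> t * \<delta> / (k - 1) \<and> 0 \<le> Re w \<and> Re w \<le> 1 / k}"

definition region3 :: "real \<Rightarrow> real \<Rightarrow> real \<Rightarrow> complex set" where
  "region3 k \<delta> t = {w. cmod (w - complex_of_real (1 / k)) \<le> t * \<delta> / (k - 1) \<and> Re w \<ge> 1 / k}"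

text \<open>The region to be avoided by the conjugate map \<open>w \<mapsto> k * w\<close>; in its first part \<open>t = k\<close>.\<close>

definition avoided_f :: "real \<Rightarrow> real \<Rightarrow> complex set" where
  "avoided_f k \<delta> = region1 k \<delta> k \<union> region2 k \<delta> 1 \<union> region3 k \<delta> 1"

text \<open>The conjugating map \<open>h z = (z - \<beta>) / (z - \<alpha>)\<close>, with \<open>\<alpha>\<close> the attracting and \<open>\<beta>\<close> the
  repelling fixed point.\<close>

definition conj_map :: "complex \<Rightarrow> complex \<Rightarrow> riemann_sphere \<Rightarrow> riemann_sphere" where
  "conj_map \<alpha> \<beta> = moebius 1 (- \<beta>) 1 (- \<alpha>)"

definition avoided_g :: "complex \<Rightarrow> complex \<Rightarrow> real \<Rightarrow> real \<Rightarrow> riemann_sphere set" where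
  "avoided_g \<alpha> \<beta> k \<delta> = conj_map \<alpha> \<beta> -` (Some ` avoided_f k \<delta>)"

text \<open>The fixed points and the real multiplier used in these definitions exist and are unique.\<close>

lemma deriv_moebius_fun:
  assumes "a * d - b * c = 1" "c * z + d \<noteq> 0"
  shows "deriv (moebius_fun a b c d) z = 1 / (c * z + d)\<^sup>2"
proof -
  have "((\<lambda>z. (a * z + b) / (c * z + d)) has_field_derivative
          (a * (c * z + d) - (a * z + b) * c) / ((c * z + d) * (c * z + d))) (at z)"
    using assms(2) by (auto intro!: derivative_eq_intros)
  moreover have "a * (c * z + d) - (a * z + b) * c = 1"
    using assms(1) by (simp add: algebra_simps)
  ultimately have "((\<lambda>z. (a * z + b) / (c * z + d)) has_field_derivative 1 / (c * z + d)\<^sup>2) (at z)"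
    by (simp add: power2_eq_square)
  then show ?thesis
    unfolding moebius_fun_def by (rule DERIV_imp_deriv)
qed

lemma moebius_fixpoint_iff:
  assumes "a * d - b * c = 1" "c \<noteq> 0"
  shows "moebius a b c d (Some z) = Some z \<longleftrightarrow> (c * z + d)\<^sup>2 - (a + d) * (c * z + d) + 1 = 0"
proof (cases "c * z + d = 0")
  case True
  then show ?thesis by (simp add: moebius_def)
next
  case False
  have "(c * z + d)\<^sup>2 - (a + d) * (c * z + d) + (a * d - b * c) = c * ((c * z + d) * z - (a * z + b))"
    by (simp add: algebra_simps power2_eq_square)
  then have "(c * z + d)\<^sup>2 - (a + d) * (c * z + d) + 1 = 0 \<longleftrightarrow> (c * z + d) * z = a * z + b"
    using assms by simp
  then show ?thesis
    using False by (auto simp: moebius_def moebius_fun_def nonzero_divide_eq_eq mult.commute)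
qed

lemma hyperbolic_fixpoints:
  assumes "hyperbolic_moebius a b c d" "c \<noteq> 0"
  shows "\<exists>!\<alpha>. attracting_fixpoint a b c d \<alpha>"
    and "\<exists>!\<beta>. repelling_fixpoint a b c d \<beta>"
    and "repelling_fixpoint a b c d \<beta> \<Longrightarrow> \<exists>k>1. complex_of_real k = 1 / (c * \<beta> + d)\<^sup>2"
proof -
  have det: "a * d - b * c = 1" using assms by (simp add: hyperbolic_moebius_def)
  obtain \<tau> where \<tau>: "a + d = complex_of_real \<tau>" "\<bar>\<tau>\<bar> > 2"
  proof -
    obtain \<tau> where "a + d = complex_of_real \<tau>" "\<tau> \<notin> {-2..2}"
      using assms(1) unfolding hyperbolic_moebius_def
      by (metis Diff_iff Reals_cases image_eqI)
    then show ?thesis by (intro that[of \<tau>]) auto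
  qed
  define s where "s = sqrt (\<tau>\<^sup>2 - 4)"
  define l m where "l = (\<tau> + sgn \<tau> * s) / 2" and "m = (\<tau> - sgn \<tau> * s) / 2"
  have "\<tau>\<^sup>2 > 4" using power_strict_mono[of 2 "\<bar>\<tau>\<bar>" 2] \<tau>(2) by simp
  then have s: "s > 0" "s\<^sup>2 = \<tau>\<^sup>2 - 4" by (auto simp: s_def)
  have sg: "sgn \<tau> * sgn \<tau> = 1" using \<tau>(2) by (auto simp: sgn_if)
  have "(sgn \<tau> * s)\<^sup>2 = s\<^sup>2" using sg by (simp add: power2_eq_square algebra_simps)
  then have lm: "l * m = 1" "l + m = \<tau>" using s(2)
    by (auto simp: l_def m_def power2_eq_square field_simps)
  have l: "\<bar>l\<bar> > 1" using s(1) \<tau>(2) by (auto simp: l_def sgn_if abs_if split: if_splits)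
  have m: "\<bar>m\<bar> < 1" "m \<noteq> 0" "l \<noteq> 0"
  proof -
    show "m \<noteq> 0" "l \<noteq> 0" using lm by auto
    have "\<bar>l\<bar> * \<bar>m\<bar> = 1" using lm(1) by (simp flip: abs_mult)
    then show "\<bar>m\<bar> < 1" using l
      by (smt (verit) mult_less_cancel_right1)
  qed
  have fp: "moebius a b c d (Some z) = Some z \<longleftrightarrow>
      c * z + d = complex_of_real l \<or> c * z + d = complex_of_real m" for z
  proof -
    have "(c * z + d)\<^sup>2 - (a + d) * (c * z + d) + 1 =
        (c * z + d - complex_of_real l) * (c * z + d - complex_of_real m)"
      unfolding \<tau>(1) lm(2)[symmetric]
      using arg_cong[OF lm(1), of complex_of_real]
      by (simp add: algebra_simps power2_eq_square)
    then show ?thesis by (simp add: moebius_fixpoint_iff[OF det assms(2)])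
  qed
  have att: "attracting_fixpoint a b c d z \<longleftrightarrow> z = (complex_of_real l - d) / c"
   and rep: "repelling_fixpoint a b c d z \<longleftrightarrow> z = (complex_of_real m - d) / c" for z
  proof -
    have D: "c * z + d = complex_of_real r \<Longrightarrow> r \<noteq> 0 \<Longrightarrow>
        cmod (deriv (moebius_fun a b c d) z) = 1 / r\<^sup>2" for r
      by (simp add: deriv_moebius_fun[OF det] norm_divide norm_power)
    have "1 / l\<^sup>2 < 1" "1 / m\<^sup>2 > 1"
      using l m abs_square_less_1[of m] abs_square_le_1[of l] by (auto simp: divide_simps not_le)
    then have "attracting_fixpoint a b c d z \<longleftrightarrow> c * z + d = complex_of_real l"
       "repelling_fixpoint a b c d z \<longleftrightarrow> c * z + d = complex_of_real m"
      unfolding attracting_fixpoint_def repelling_fixpoint_def fp using D m by auto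
    then show "attracting_fixpoint a b c d z \<longleftrightarrow> z = (complex_of_real l - d) / c"
      "repelling_fixpoint a b c d z \<longleftrightarrow> z = (complex_of_real m - d) / c"
      using assms(2) by (auto simp: field_simps)
  qed
  show "\<exists>!\<alpha>. attracting_fixpoint a b c d \<alpha>" "\<exists>!\<beta>. repelling_fixpoint a b c d \<beta>"
    by (simp_all add: att rep)
  show "\<exists>k>1. complex_of_real k = 1 / (c * \<beta> + d)\<^sup>2" if "repelling_fixpoint a b c d \<beta>"
  proof (intro exI conjI)
    show "1 / m\<^sup>2 > 1" using m abs_square_less_1[of m] by (auto simp: divide_simps)
    show "complex_of_real (1 / m\<^sup>2) = 1 / (c * \<beta> + d)\<^sup>2"
      using that assms(2) by (simp add: rep)
  qed
qed

end

theory Submission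
  imports Defs
begin

text \<open>
  The shadowing orbit can be taken to start at the same point, \<open>y 0 = x 0\<close>, and \<open>H\<close> to be linear.
  Two facts carry the argument. Write \<open>t = \<delta> / (k - 1)\<close> and \<open>w = (z - \<beta>) / (z - \<alpha>)\<close>, so that the map
  becomes \<open>w \<mapsto> k * w\<close>, its pole lies at \<open>w = 1 / k\<close> and infinity lies at \<open>w = 1\<close>.

  The first fact is that pseudo-orbits stay away from the pole. The avoided region contains all points
  at distance at most \<open>t\<close> from the segment \<open>[0, 1 / k]\<close>. If \<open>w\<close> has distance at least \<open>t\<close> from this
  segment, then \<open>k * w\<close> has distance at least \<open>k * t\<close> from the longer segment \<open>[0, 1]\<close>, and the gain
  \<open>k * t - t = \<delta>\<close> absorbs a small error (lemma \<open>perturbed_image_in_safe\<close>). The chart \<open>w\<close> distorts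
  errors without bound at \<open>\<alpha>\<close>; the inequality is therefore multiplied by \<open>\<bar>z - \<alpha>\<bar>\<close>, and
  points close to \<open>\<alpha>\<close> satisfy it because its left-hand side becomes small.

  The second fact is a uniform contraction of exact orbits. For two points with coordinates \<open>w\<close>, \<open>w'\<close>
  the distance of the \<open>m\<close>-th images is the original distance times
  \<open>k\<^sup>m * (\<bar>w - 1\<bar> / \<bar>k\<^sup>m * w - 1\<bar>) * (\<bar>w' - 1\<bar> / \<bar>k\<^sup>m * w' - 1\<bar>)\<close>.
  For \<open>m \<ge> 1\<close> the number \<open>1 / k\<^sup>m\<close> belongs to \<open>[0, 1 / k]\<close>, so the distance condition bounds
  \<open>\<bar>w - 1\<bar> / \<bar>w - 1 / k\<^sup>m\<bar>\<close> by \<open>1 + 1 / t\<close>, and the whole factor by \<open>(1 + 1 / t)\<^sup>2 / k\<^sup>m\<close>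
  (lemma \<open>iterates_contract\<close>).

  The difference \<open>x n - y n\<close> then telescopes over the times \<open>j\<close> at which the errors are made. The error
  made \<open>m\<close> steps before time \<open>n\<close> contributes at most \<open>(1 + 1 / t)\<^sup>2 * \<epsilon> / k\<^sup>m\<close>, and the
  geometric series gives a bound independent of \<open>n\<close>.
\<close>

section \<open>The map at its fixed points\<close>

text \<open>The real number \<open>t\<close> measures how far the pseudo-orbits are kept from the pole.\<close>

locale normalized_moebius =
  fixes a b c d \<alpha> \<beta> :: complex and k t :: real
  assumes det: "a * d - b * c = 1"
    and attracting_nonpole: "c * \<alpha> + d \<noteq> 0"
    and repelling_nonpole: "c * \<beta> + d \<noteq> 0"
    and fix_attracting: "moebius_fun a b c d \<alpha> = \<alpha>"
    and fix_repelling: "moebius_fun a b c d \<beta> = \<beta>"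
    and fixpoints_distinct: "\<alpha> \<noteq> \<beta>"
    and multipliers_inverse: "(c * \<alpha> + d) * (c * \<beta> + d) = 1"
    and multiplier: "complex_of_real k = (c * \<alpha> + d)\<^sup>2"
    and k_gt_1: "1 < k"
    and t_pos: "0 < t"
begin

abbreviation g :: "complex \<Rightarrow> complex" where
  "g \<equiv> moebius_fun a b c d"

section \<open>Pseudo-orbits avoiding the pole\<close>

text \<open>In the coordinate \<open>w\<close> this is the set of points at distance at least \<open>t\<close> from the segment
  \<open>[0, 1 / k]\<close>. Multiplication by \<open>z - \<alpha>\<close> lets the condition make sense at \<open>z = \<alpha>\<close>,
  where \<open>w\<close> is infinite.\<close>

definition safe :: "complex set" where
  "safe = {z. \<forall>s\<in>{0..1/k}. t * cmod (z - \<alpha>) \<le> cmod ((z - \<beta>) - complex_of_real s * (z - \<alpha>))}"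

lemma safeD:
  "z \<in> safe \<Longrightarrow> 0 \<le> s \<Longrightarrow> s \<le> 1 / k \<Longrightarrow>
     t * cmod (z - \<alpha>) \<le> cmod ((z - \<beta>) - complex_of_real s * (z - \<alpha>))"
  by (simp add: safe_def)

text \<open>For \<open>s < 1\<close> the left-hand side vanishes only at the finite point with coordinate \<open>w = s\<close>;
  \<open>s = 0\<close> gives the repelling fixed point and \<open>s = 1 / k\<close> the pole.\<close>

lemma safe_nonzero:
  assumes "z \<in> safe" "0 \<le> s" "s \<le> 1 / k"
  shows "(z - \<beta>) - complex_of_real s * (z - \<alpha>) \<noteq> 0"
proof
  assume eq: "(z - \<beta>) - complex_of_real s * (z - \<alpha>) = 0"
  then have "t * cmod (z - \<alpha>) \<le> 0"
    using safeD[OF assms] by simp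
  then have "z = \<alpha>"
    using t_pos by (simp add: mult_le_0_iff)
  then show False
    using eq fixpoints_distinct by simp
qed

lemma safe_neq_repelling: "z \<in> safe \<Longrightarrow> z \<noteq> \<beta>"
  using safe_nonzero[of z 0] k_gt_1 by auto

lemma inverse_multiplier: "complex_of_real (1 / k) = (c * \<beta> + d)\<^sup>2"
proof -
  have "complex_of_real k * (c * \<beta> + d)\<^sup>2 = 1"
    using multipliers_inverse by (simp add: multiplier flip: power_mult_distrib)
  then show ?thesis
    using k_gt_1 by (simp add: field_simps)
qed

text \<open>Both sides are affine in \<open>z\<close> and agree at the two fixed points.\<close>

lemma denominator_eq:
  "(c * z + d) * (\<alpha> - \<beta>) = (c * \<alpha> + d) * ((z - \<beta>) - complex_of_real (1 / k) * (z - \<alpha>))"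
proof -
  have "(c * \<alpha> + d) * ((z - \<beta>) - (c * \<beta> + d)\<^sup>2 * (z - \<alpha>)) =
      (c * \<alpha> + d) * (z - \<beta>) - ((c * \<alpha> + d) * (c * \<beta> + d)) * (c * \<beta> + d) * (z - \<alpha>)"
    by (simp add: algebra_simps power2_eq_square)
  also have "\<dots> = (c * z + d) * (\<alpha> - \<beta>)"
    unfolding multipliers_inverse by (simp add: algebra_simps)
  finally show ?thesis
    unfolding inverse_multiplier by simp
qed

lemma safe_nonpole: "z \<in> safe \<Longrightarrow> c * z + d \<noteq> 0"
  using denominator_eq[of z] safe_nonzero[of z "1/k"] attracting_nonpole k_gt_1 by auto

lemma moebius_diff:
  assumes "c * z + d \<noteq> 0" "c * z' + d \<noteq> 0"
  shows "g z - g z' = (z - z') / ((c * z + d) * (c * z' + d))"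
proof -
  have "(a * z + b) * (c * z' + d) - (a * z' + b) * (c * z + d) = (a * d - b * c) * (z - z')"
    by (simp add: algebra_simps)
  then show ?thesis
    using assms by (simp add: moebius_fun_def diff_frac_eq det)
qed

lemma image_minus_attracting:
  assumes "c * z + d \<noteq> 0"
  shows "g z - \<alpha> = (c * \<beta> + d) * (z - \<alpha>) / (c * z + d)"
proof -
  have "1 / (c * \<alpha> + d) = c * \<beta> + d"
    using multipliers_inverse attracting_nonpole by (simp add: field_simps)
  moreover have "g z - \<alpha> = (1 / (c * \<alpha> + d)) * (z - \<alpha>) / (c * z + d)"
    using moebius_diff[OF assms attracting_nonpole] by (simp add: fix_attracting mult.commute)
  ultimately show ?thesis by simp
qed

lemma image_minus_repelling:
  assumes "c * z + d \<noteq> 0"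
  shows "g z - \<beta> = (c * \<alpha> + d) * (z - \<beta>) / (c * z + d)"
proof -
  have "1 / (c * \<beta> + d) = c * \<alpha> + d"
    using multipliers_inverse repelling_nonpole by (simp add: field_simps)
  moreover have "g z - \<beta> = (1 / (c * \<beta> + d)) * (z - \<beta>) / (c * z + d)"
    using moebius_diff[OF assms repelling_nonpole] by (simp add: fix_repelling mult.commute)
  ultimately show ?thesis by simp
qed

text \<open>Multiplication by \<open>k\<close> stretches both the segment \<open>[0, 1 / k]\<close> and the distance \<open>t\<close> from it.\<close>

lemma image_distance:
  assumes z: "z \<in> safe" and s: "0 \<le> s" "s \<le> 1"
  shows "k * t * cmod (g z - \<alpha>) \<le> cmod ((g z - \<beta>) - complex_of_real s * (g z - \<alpha>))"
proof -
  let ?l = "c * \<alpha> + d" and ?m = "c * \<beta> + d" and ?D = "c * z + d"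
  have D: "?D \<noteq> 0" using z by (rule safe_nonpole)
  have m: "?m = ?l * complex_of_real (1 / k)"
    unfolding inverse_multiplier power2_eq_square mult.assoc[symmetric] multipliers_inverse by simp
  have km: "k * cmod ?m = cmod ?l"
    using k_gt_1 by (subst m) (simp add: norm_mult norm_divide)
  have "(g z - \<beta>) - complex_of_real s * (g z - \<alpha>)
      = ?l / ?D * ((z - \<beta>) - complex_of_real (s / k) * (z - \<alpha>))"
    unfolding image_minus_attracting[OF D] image_minus_repelling[OF D] m
    by (simp add: algebra_simps diff_divide_distrib add_divide_distrib)
  then have rhs: "cmod ((g z - \<beta>) - complex_of_real s * (g z - \<alpha>))
      = cmod ?l / cmod ?D * cmod ((z - \<beta>) - complex_of_real (s / k) * (z - \<alpha>))"
    by (simp add: norm_mult norm_divide)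
  have "k * t * cmod (g z - \<alpha>) = (k * cmod ?m) / cmod ?D * (t * cmod (z - \<alpha>))"
    unfolding image_minus_attracting[OF D] by (simp add: norm_mult norm_divide)
  also have "\<dots> = cmod ?l / cmod ?D * (t * cmod (z - \<alpha>))"
    unfolding km ..
  also have "\<dots> \<le> cmod ?l / cmod ?D * cmod ((z - \<beta>) - complex_of_real (s / k) * (z - \<alpha>))"
  proof (rule mult_left_mono)
    show "t * cmod (z - \<alpha>) \<le> cmod ((z - \<beta>) - complex_of_real (s / k) * (z - \<alpha>))"
      using s k_gt_1 by (intro safeD[OF z]) (auto intro: divide_right_mono)
  qed simp
  finally show ?thesis
    unfolding rhs .
qed

text \<open>A point far from \<open>\<alpha>\<close> inherits the condition from the exact image, whose distance \<open>k * t\<close> leaves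
  room for the error. Close to \<open>\<alpha>\<close> that room shrinks to nothing, but there the left-hand side
  of the condition is small and the right-hand side is close to \<open>\<bar>\<alpha> - \<beta>\<bar>\<close>.\<close>

lemma perturbed_image_in_safe:
  assumes z: "z \<in> safe" and err: "cmod (z' - g z) \<le> \<epsilon>"
    and small: "\<epsilon> * ((1 + k * t) * (1 + t)) \<le> (k - 1) * t * cmod (\<alpha> - \<beta>)"
  shows "z' \<in> safe"
  unfolding safe_def
proof (intro CollectI ballI)
  fix s :: real
  assume "s \<in> {0..1/k}"
  moreover have "1 / k \<le> 1" using k_gt_1 by simp
  ultimately have s: "0 \<le> s" "s \<le> 1" by auto
  define e where "e = z' - g z"
  let ?X = "(z' - \<beta>) - complex_of_real s * (z' - \<alpha>)"
  have gap: "0 < (k - 1) * t" using k_gt_1 t_pos by simp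
  have scaled: "cmod (complex_of_real (1 - s) * u) \<le> cmod u" for u
    unfolding norm_mult norm_of_real using s by (intro mult_left_le_one_le) auto
  show "t * cmod (z' - \<alpha>) \<le> cmod ?X"
  proof (cases "(1 + k * t) * \<epsilon> \<le> (k - 1) * t * cmod (z' - \<alpha>)")
    case True
    have "cmod (z' - \<alpha>) \<le> cmod (g z - \<alpha>) + cmod e"
      using norm_triangle_ineq[of "g z - \<alpha>" e] by (simp add: e_def)
    then have "k * t * cmod (z' - \<alpha>) \<le> k * t * (cmod (g z - \<alpha>) + cmod e)"
      using k_gt_1 t_pos by (intro mult_left_mono) auto
    also have "\<dots> = k * t * cmod (g z - \<alpha>) + k * t * cmod e"
      by (simp add: algebra_simps)
    finally have 1: "k * t * cmod (z' - \<alpha>) \<le> k * t * cmod (g z - \<alpha>) + k * t * cmod e" .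
    have eq: "(g z - \<beta>) - complex_of_real s * (g z - \<alpha>) = ?X - complex_of_real (1 - s) * e"
      by (simp add: e_def algebra_simps)
    have "cmod ((g z - \<beta>) - complex_of_real s * (g z - \<alpha>)) \<le> cmod ?X + cmod e"
      unfolding eq using norm_triangle_ineq4[of ?X "complex_of_real (1 - s) * e"] scaled[of e]
      by linarith
    with image_distance[OF z s] have 2: "k * t * cmod (g z - \<alpha>) \<le> cmod ?X + cmod e"
      by linarith
    have 3: "(1 + k * t) * cmod e \<le> (1 + k * t) * \<epsilon>"
      using err k_gt_1 t_pos by (intro mult_left_mono) (auto simp: e_def)
    have "(1 + k * t) * cmod e = cmod e + k * t * cmod e"
      "(k - 1) * t * cmod (z' - \<alpha>) = k * t * cmod (z' - \<alpha>) - t * cmod (z' - \<alpha>)"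
      by (simp_all add: algebra_simps)
    with 1 2 3 True show ?thesis by linarith
  next
    case False
    then have "(k - 1) * t * cmod (z' - \<alpha>) * (1 + t) \<le> (1 + k * t) * \<epsilon> * (1 + t)"
      using t_pos by (intro mult_right_mono) auto
    with small have "(k - 1) * t * (cmod (z' - \<alpha>) * (1 + t)) \<le> (k - 1) * t * cmod (\<alpha> - \<beta>)"
      by (simp add: mult_ac)
    then have "cmod (z' - \<alpha>) * (1 + t) \<le> cmod (\<alpha> - \<beta>)"
      using mult_le_cancel_left_pos[OF gap] by blast
    then have 1: "cmod (z' - \<alpha>) + t * cmod (z' - \<alpha>) \<le> cmod (\<alpha> - \<beta>)"
      by (simp add: algebra_simps)
    have eq: "\<alpha> - \<beta> = ?X - complex_of_real (1 - s) * (z' - \<alpha>)"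
      by (simp add: algebra_simps)
    have "cmod (\<alpha> - \<beta>) \<le> cmod ?X + cmod (z' - \<alpha>)"
      using norm_triangle_ineq4[of ?X "complex_of_real (1 - s) * (z' - \<alpha>)"] scaled[of "z' - \<alpha>"]
      unfolding eq[symmetric] by linarith
    with 1 show ?thesis by linarith
  qed
qed

lemma image_in_safe: "z \<in> safe \<Longrightarrow> g z \<in> safe"
  using perturbed_image_in_safe[of z "g z" 0] k_gt_1 t_pos by simp

lemma iterate_in_safe: "z \<in> safe \<Longrightarrow> (g ^^ m) z \<in> safe"
  by (induction m) (auto intro: image_in_safe)

section \<open>Contraction of exact orbits\<close>

text \<open>The coordinate \<open>1 / w\<close>, rather than \<open>w\<close>, is finite on the whole safe set, since the safe set
  contains \<open>\<alpha>\<close> but not \<open>\<beta>\<close>.\<close>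

definition chart :: "complex \<Rightarrow> complex" where
  "chart z = (z - \<alpha>) / (z - \<beta>)"

lemma chart_image:
  assumes "z \<in> safe"
  shows "chart (g z) = complex_of_real (1 / k) * chart z"
proof -
  have D: "c * z + d \<noteq> 0" using assms by (rule safe_nonpole)
  have "chart (g z) = (c * \<beta> + d) / (c * \<alpha> + d) * chart z"
    unfolding chart_def image_minus_attracting[OF D] image_minus_repelling[OF D]
    using D by simp
  also have "(c * \<beta> + d) / (c * \<alpha> + d) = complex_of_real (1 / k)"
  proof -
    have "(c * \<beta> + d)\<^sup>2 * (c * \<alpha> + d) = c * \<beta> + d"
      using multipliers_inverse by (simp add: power2_eq_square mult.assoc mult.commute)
    then show ?thesis
      unfolding inverse_multiplier using attracting_nonpole by (simp add: divide_eq_eq)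
  qed
  finally show ?thesis .
qed

lemma chart_iterate:
  assumes "z \<in> safe"
  shows "chart ((g ^^ m) z) = complex_of_real ((1 / k) ^ m) * chart z"
proof (induction m)
  case (Suc m)
  have "chart ((g ^^ Suc m) z) = complex_of_real (1 / k) * chart ((g ^^ m) z)"
    using chart_image[OF iterate_in_safe[OF assms]] by simp
  then show ?case
    unfolding Suc.IH by simp
qed simp

lemma chart_neq_1: "chart z \<noteq> 1"
  using fixpoints_distinct by (cases "z = \<beta>") (auto simp: chart_def)

lemma minus_repelling_eq:
  assumes "z \<noteq> \<beta>"
  shows "z - \<beta> = (\<alpha> - \<beta>) / (1 - chart z)"
proof -
  have "1 - chart z = (\<alpha> - \<beta>) / (z - \<beta>)"
    using assms by (simp add: chart_def field_simps)
  then show ?thesis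
    using assms fixpoints_distinct by simp
qed

lemma chart_diff:
  assumes "z \<noteq> \<beta>" "z' \<noteq> \<beta>"
  shows "z - z' = (\<alpha> - \<beta>) * (chart z - chart z') / ((1 - chart z) * (1 - chart z'))"
proof -
  have "z - z' = (\<alpha> - \<beta>) / (1 - chart z) - (\<alpha> - \<beta>) / (1 - chart z')"
    using minus_repelling_eq[OF assms(1)] minus_repelling_eq[OF assms(2)]
    by (metis diff_diff_eq2 diff_add_cancel)
  also have "\<dots> = (\<alpha> - \<beta>) * (chart z - chart z') / ((1 - chart z) * (1 - chart z'))"
    using chart_neq_1[of z] chart_neq_1[of z'] by (simp add: diff_frac_eq) (simp add: algebra_simps)
  finally show ?thesis .
qed

text \<open>In terms of \<open>w\<close> this bounds \<open>\<bar>w - 1\<bar> / \<bar>w - s\<bar>\<close> through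
  \<open>\<bar>w - 1\<bar> \<le> \<bar>w - s\<bar> + 1\<close> and \<open>\<bar>w - s\<bar> \<ge> t\<close>.\<close>

lemma chart_ratio_bound:
  assumes z: "z \<in> safe" and s: "0 \<le> s" "s \<le> 1 / k"
  shows "cmod (1 - chart z) \<le> (1 + 1 / t) * cmod (1 - complex_of_real s * chart z)"
proof -
  let ?v = "chart z"
  have nz: "z - \<beta> \<noteq> 0" using safe_neq_repelling[OF z] by simp
  have "1 / k \<le> 1" using k_gt_1 by simp
  with s have s1: "s \<le> 1" by simp
  have "1 - complex_of_real s * ?v = ((z - \<beta>) - complex_of_real s * (z - \<alpha>)) / (z - \<beta>)"
    using nz by (simp add: chart_def diff_divide_eq_iff)
  then have "t * cmod ?v \<le> cmod (1 - complex_of_real s * ?v)"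
    using safeD[OF z s] nz by (simp add: chart_def norm_divide divide_right_mono)
  then have v: "cmod ?v \<le> 1 / t * cmod (1 - complex_of_real s * ?v)"
    using t_pos by (simp add: field_simps)
  have "1 - ?v = (1 - complex_of_real s * ?v) - complex_of_real (1 - s) * ?v"
    by (simp add: algebra_simps)
  then have "cmod (1 - ?v) \<le> cmod (1 - complex_of_real s * ?v) + cmod (complex_of_real (1 - s) * ?v)"
    by (metis norm_triangle_ineq4)
  also have "cmod (complex_of_real (1 - s) * ?v) \<le> cmod ?v"
    unfolding norm_mult norm_of_real using s(1) s1 by (intro mult_left_le_one_le) auto
  finally show ?thesis using v by (simp add: algebra_simps)
qed

text \<open>The \<open>m\<close>-th iterate is multiplication by \<open>(1 / k) ^ m\<close> in the chart; the remaining two factors compare the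
  chart's distortion at the start and at the end of the orbit.\<close>

lemma iterates_contract:
  assumes z: "z \<in> safe" and z': "z' \<in> safe"
  shows "cmod ((g ^^ m) z - (g ^^ m) z') \<le> (1 + 1 / t)\<^sup>2 * (1 / k) ^ m * cmod (z - z')"
proof -
  define q where "q = (1 / k) ^ m"
  define C where "C = 1 + 1 / t"
  have C: "1 \<le> C" using t_pos by (simp add: C_def)
  have q0: "0 \<le> q" using k_gt_1 by (simp add: q_def)
  have ratio: "cmod (1 - chart u) / cmod (1 - complex_of_real q * chart u) \<le> C"
    if u: "u \<in> safe" for u
  proof (cases "m = 0")
    case True
    then show ?thesis using C by (simp add: q_def)
  next
    case False
    then have "q \<le> (1 / k) ^ 1"
      unfolding q_def using k_gt_1 by (intro power_decreasing) auto
    then have "cmod (1 - chart u) \<le> C * cmod (1 - complex_of_real q * chart u)"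
      unfolding C_def using chart_ratio_bound[OF u q0] by simp
    moreover have "1 - complex_of_real q * chart u \<noteq> 0"
      using chart_neq_1[of "(g ^^ m) u"] by (simp add: chart_iterate[OF u] q_def)
    ultimately show ?thesis by (simp add: divide_le_eq)
  qed
  have insert_factors: "X / (D * D') = X / (E * E') * (E / D) * (E' / D')"
    if "E \<noteq> 0" "E' \<noteq> 0" for X D D' E E' :: complex
    using that by simp
  have ne: "1 - chart z \<noteq> 0" "1 - chart z' \<noteq> 0"
    using chart_neq_1[of z] chart_neq_1[of z'] by auto
  have "(g ^^ m) z - (g ^^ m) z' =
      (\<alpha> - \<beta>) * (complex_of_real q * chart z - complex_of_real q * chart z') /
      ((1 - complex_of_real q * chart z) * (1 - complex_of_real q * chart z'))"
    using chart_diff[of "(g ^^ m) z" "(g ^^ m) z'"] iterate_in_safe[OF z] iterate_in_safe[OF z']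
    by (simp add: safe_neq_repelling chart_iterate z z' q_def)
  also have "\<dots> = complex_of_real q * ((\<alpha> - \<beta>) * (chart z - chart z')) /
      ((1 - complex_of_real q * chart z) * (1 - complex_of_real q * chart z'))"
    by (simp add: right_diff_distrib mult_ac)
  also have "\<dots> = complex_of_real q * ((\<alpha> - \<beta>) * (chart z - chart z')) /
      ((1 - chart z) * (1 - chart z')) *
      ((1 - chart z) / (1 - complex_of_real q * chart z)) *
      ((1 - chart z') / (1 - complex_of_real q * chart z'))"
    using ne by (rule insert_factors)
  also have "\<dots> = complex_of_real q * (z - z') *
      ((1 - chart z) / (1 - complex_of_real q * chart z)) *
      ((1 - chart z') / (1 - complex_of_real q * chart z'))"
    unfolding chart_diff[OF safe_neq_repelling[OF z] safe_neq_repelling[OF z']] by simp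
  finally have "cmod ((g ^^ m) z - (g ^^ m) z') = q * cmod (z - z') *
      (cmod (1 - chart z) / cmod (1 - complex_of_real q * chart z)) *
      (cmod (1 - chart z') / cmod (1 - complex_of_real q * chart z'))"
    using q0 by (simp add: norm_mult norm_divide)
  also have "\<dots> \<le> q * cmod (z - z') * C * C"
    using ratio[OF z] ratio[OF z'] q0 C by (intro mult_mono) auto
  finally show ?thesis
    by (simp add: q_def C_def power2_eq_square mult_ac)
qed

section \<open>Shadowing\<close>

text \<open>Replacing \<open>g (x j)\<close> by \<open>x (j + 1)\<close> at one time after another leads from the exact orbit to the
  pseudo-orbit; the change made at time \<open>j\<close> has been contracted for \<open>n - 1 - j\<close> steps by time \<open>n\<close>.\<close>

lemma pseudo_orbit_shadowed:
  assumes safe: "\<And>i. x i \<in> safe" and err: "\<And>i. cmod (x (Suc i) - g (x i)) \<le> \<epsilon>"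
  shows "cmod (x n - (g ^^ n) (x 0)) \<le> (1 + 1 / t)\<^sup>2 * (k / (k - 1)) * \<epsilon>"
proof -
  define C where "C = (1 + 1 / t)\<^sup>2"
  have C: "0 \<le> C" by (simp add: C_def)
  have eps: "0 \<le> \<epsilon>" using err[of 0] norm_ge_zero order_trans by blast
  define T where "T j = (g ^^ (n - j)) (x j)" for j
  have step: "cmod (T (Suc j) - T j) \<le> C * \<epsilon> * (1 / k) ^ (n - Suc j)" if "j < n" for j
  proof -
    have "n - j = Suc (n - Suc j)" using that by simp
    then have "T j = (g ^^ (n - Suc j)) (g (x j))"
      unfolding T_def by (simp only: funpow_Suc_right o_apply)
    then have "cmod (T (Suc j) - T j) \<le> C * (1 / k) ^ (n - Suc j) * cmod (x (Suc j) - g (x j))"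
      unfolding C_def T_def using iterates_contract[OF safe image_in_safe[OF safe]] by simp
    also have "\<dots> \<le> C * (1 / k) ^ (n - Suc j) * \<epsilon>"
      using err C k_gt_1 by (intro mult_left_mono) auto
    finally show ?thesis by (simp add: mult_ac)
  qed
  have "x n - (g ^^ n) (x 0) = T n - T 0"
    by (simp add: T_def)
  also have "\<dots> = (\<Sum>j<n. T (Suc j) - T j)"
    by (rule sum_lessThan_telescope[symmetric])
  finally have "cmod (x n - (g ^^ n) (x 0)) \<le> (\<Sum>j<n. C * \<epsilon> * (1 / k) ^ (n - Suc j))"
    using step by (simp only:) (intro sum_norm_le, simp)
  also have "\<dots> = C * \<epsilon> * (\<Sum>j<n. (1 / k) ^ j)"
    unfolding sum_distrib_left[symmetric] by (simp only: sum.nat_diff_reindex)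
  also have "\<dots> \<le> C * \<epsilon> * (k / (k - 1))"
  proof (rule mult_left_mono)
    have "(\<Sum>j<n. (1 / k) ^ j) \<le> (\<Sum>j. (1 / k) ^ j)"
      using k_gt_1 by (intro sum_le_suminf summable_geometric) auto
    also have "\<dots> = 1 / (1 - 1 / k)"
      using k_gt_1 by (intro suminf_geometric) auto
    also have "\<dots> = k / (k - 1)"
      using k_gt_1 by (simp add: field_simps)
    finally show "(\<Sum>j<n. (1 / k) ^ j) \<le> k / (k - 1)" .
  qed (use C eps in simp)
  finally show ?thesis by (simp add: C_def mult_ac)
qed

lemma safe_moebius: "z \<in> safe \<Longrightarrow> moebius a b c d (Some z) = Some (g z)"
  by (simp add: moebius_def safe_nonpole)

end

section \<open>The avoided region and the hyperbolic case\<close>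

text \<open>The avoided region contains the closed \<open>\<delta> / (k - 1)\<close>-neighbourhood of the segment \<open>[0, 1 / k]\<close>:
  the nearest point of the segment is an end point for points beyond it, and
  the vertical projection for the others.\<close>

lemma segment_neighbourhood_avoided:
  assumes k: "1 < k" and \<delta>: "0 < \<delta>" and s: "0 \<le> s" "s \<le> 1 / k"
    and near: "cmod (w - complex_of_real s) \<le> \<delta> / (k - 1)"
  shows "w \<in> avoided_f k \<delta>"
proof -
  consider "Re w \<le> 0" | "0 \<le> Re w" "Re w \<le> 1 / k" | "1 / k \<le> Re w"
    by linarith
  then show ?thesis
  proof cases
    case 1
    have "(Re w)\<^sup>2 \<le> (Re w - s)\<^sup>2"
      using 1 s by (intro abs_le_square_iff[THEN iffD1]) auto
    then have "cmod w \<le> cmod (w - complex_of_real s)"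
      by (simp add: cmod_def)
    also have "\<dots> \<le> \<delta> / (k - 1)"
      by (rule near)
    also have "\<dots> \<le> k * \<delta> / (k - 1)"
      using k \<delta> by (intro divide_right_mono) auto
    finally show ?thesis
      using 1 by (simp add: avoided_f_def region1_def)
  next
    case 2
    have "\<bar>Im w\<bar> \<le> cmod (w - complex_of_real s)"
      using abs_Im_le_cmod[of "w - complex_of_real s"] by simp
    then show ?thesis
      using 2 near by (simp add: avoided_f_def region2_def)
  next
    case 3
    have "(Re w - 1 / k)\<^sup>2 \<le> (Re w - s)\<^sup>2"
      using 3 s by (intro abs_le_square_iff[THEN iffD1]) auto
    then have "cmod (w - complex_of_real (1 / k)) \<le> cmod (w - complex_of_real s)"
      by (simp add: cmod_def)
    then show ?thesis
      using 3 near by (simp add: avoided_f_def region3_def)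
  qed
qed

lemma (in normalized_moebius) start_in_safe:
  assumes \<delta>: "t = \<delta> / (k - 1)" and z: "Some z \<notin> avoided_g \<alpha> \<beta> k \<delta>"
  shows "z \<in> safe"
  unfolding safe_def
proof (intro CollectI ballI)
  fix s :: real
  assume s: "s \<in> {0..1/k}"
  have \<delta>0: "0 < \<delta>" using t_pos k_gt_1 by (simp add: \<delta> zero_less_divide_iff)
  show "t * cmod (z - \<alpha>) \<le> cmod ((z - \<beta>) - complex_of_real s * (z - \<alpha>))"
  proof (cases "z = \<alpha>")
    case False
    define w where "w = (z - \<beta>) / (z - \<alpha>)"
    have "conj_map \<alpha> \<beta> (Some z) = Some w"
      using False by (simp add: conj_map_def moebius_def moebius_fun_def w_def)
    with z have "w \<notin> avoided_f k \<delta>"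
      by (auto simp: avoided_g_def)
    then have "t \<le> cmod (w - complex_of_real s)"
      using segment_neighbourhood_avoided[OF k_gt_1 \<delta>0, of s w] s by (force simp: \<delta>)
    then have "t * cmod (z - \<alpha>) \<le> cmod (w - complex_of_real s) * cmod (z - \<alpha>)"
      by (intro mult_right_mono) auto
    also have "\<dots> = cmod ((z - \<beta>) - complex_of_real s * (z - \<alpha>))"
      using False unfolding norm_mult[symmetric] left_diff_distrib by (simp add: w_def)
    finally show ?thesis .
  qed simp
qed

text \<open>The denominators \<open>c * \<alpha> + d\<close> and \<open>c * \<beta> + d\<close> are the two distinct roots of
  \<open>X\<^sup>2 - (a + d) * X + 1\<close>, so their product is \<open>1\<close>.\<close>

lemma hyperbolic_normalized:
  assumes hyp: "hyperbolic_moebius a b c d" and c: "c \<noteq> 0"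
    and att: "attracting_fixpoint a b c d \<alpha>" and rep: "repelling_fixpoint a b c d \<beta>"
    and k: "complex_of_real k = 1 / (c * \<beta> + d)\<^sup>2" and t: "0 < t"
  shows "normalized_moebius a b c d \<alpha> \<beta> k t"
proof -
  let ?l = "c * \<alpha> + d" and ?m = "c * \<beta> + d"
  have det: "a * d - b * c = 1"
    using hyp by (simp add: hyperbolic_moebius_def)
  have fixed: "moebius a b c d (Some \<alpha>) = Some \<alpha>" "moebius a b c d (Some \<beta>) = Some \<beta>"
    using att rep by (auto simp: attracting_fixpoint_def repelling_fixpoint_def)
  then have nonpole: "?l \<noteq> 0" "?m \<noteq> 0"
    and fun_fixes: "moebius_fun a b c d \<alpha> = \<alpha>" "moebius_fun a b c d \<beta> = \<beta>"
    by (auto simp: moebius_def split: if_splits)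
  have "\<alpha> \<noteq> \<beta>"
    using att rep by (auto simp: attracting_fixpoint_def repelling_fixpoint_def)
  then have ne: "?l \<noteq> ?m" using c by simp
  have l: "?l\<^sup>2 - (a + d) * ?l + 1 = 0" and m: "?m\<^sup>2 - (a + d) * ?m + 1 = 0"
    using fixed moebius_fixpoint_iff[OF det c] by auto
  have "(?l - ?m) * (?l * ?m - 1) = (?l\<^sup>2 - (a + d) * ?l + 1) * ?m - (?m\<^sup>2 - (a + d) * ?m + 1) * ?l"
    by (simp add: algebra_simps power2_eq_square)
  also have "\<dots> = 0" unfolding l m by simp
  finally have prod: "?l * ?m = 1" using ne by simp
  have "?l\<^sup>2 * ?m\<^sup>2 = 1" using prod by (simp flip: power_mult_distrib)
  then have "complex_of_real k = ?l\<^sup>2"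
    unfolding k using nonpole by (simp add: divide_eq_eq)
  moreover have "1 < k"
    using hyperbolic_fixpoints(3)[OF hyp c rep] k by (metis of_real_eq_iff)
  ultimately show ?thesis
    using det nonpole fun_fixes \<open>\<alpha> \<noteq> \<beta>\<close> prod t by unfold_locales auto
qed

theorem theorem7p5:
  fixes a b c d \<alpha> \<beta> :: complex and k \<delta> :: real
  assumes "hyperbolic_moebius a b c d" and "c \<noteq> 0"
    and "attracting_fixpoint a b c d \<alpha>" and "repelling_fixpoint a b c d \<beta>"
    and "complex_of_real k = 1 / (c * \<beta> + d)\<^sup>2"
    and "0 < \<delta>" and "\<delta> < (1 - 1 / k)\<^sup>2"
  shows "\<exists>\<epsilon>\<^sub>0>0. \<exists>H :: real \<Rightarrow> real.
    (\<forall>\<epsilon>\<in>{0<..<\<epsilon>\<^sub>0}. H \<epsilon> > 0) \<and>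
    (H \<longlongrightarrow> 0) (at 0 within {0<..<\<epsilon>\<^sub>0}) \<and>
    (\<forall>\<epsilon>\<in>{0<..<\<epsilon>\<^sub>0}. \<forall>x :: nat \<Rightarrow> complex.
       Some (x 0) \<notin> avoided_g \<alpha> \<beta> k \<delta> \<and>
       (\<forall>i. \<exists>w. moebius a b c d (Some (x i)) = Some w \<and> cmod (x (Suc i) - w) \<le> \<epsilon>)
       \<longrightarrow> (\<exists>y :: nat \<Rightarrow> complex.
             (\<forall>i. moebius a b c d (Some (y i)) = Some (y (Suc i))) \<and>
             (\<forall>i. cmod (x i - y i) \<le> H \<epsilon>)))"
proof -
  have "1 < k"
    using hyperbolic_fixpoints(3)[OF assms(1,2,4)] assms(5) by (metis of_real_eq_iff)
  define t where "t = \<delta> / (k - 1)"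
  have "0 < t" using \<open>1 < k\<close> assms(6) by (simp add: t_def)
  interpret normalized_moebius a b c d \<alpha> \<beta> k t
    using assms(1-5) \<open>0 < t\<close> by (rule hyperbolic_normalized)
  define L where "L = (1 + 1 / t)\<^sup>2 * (k / (k - 1))"
  \<comment> \<open>the largest error for which the safe set is forward invariant by the perturbation lemma\<close>
  define \<epsilon>\<^sub>0 where "\<epsilon>\<^sub>0 = (k - 1) * t * cmod (\<alpha> - \<beta>) / ((1 + k * t) * (1 + t))"
  have denom: "0 < (1 + k * t) * (1 + t)"
    using k_gt_1 t_pos by (simp add: add_pos_pos)
  have eps0: "0 < \<epsilon>\<^sub>0"
    unfolding \<epsilon>\<^sub>0_def using denom k_gt_1 t_pos fixpoints_distinct by (intro divide_pos_pos) auto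
  have "0 < 1 + 1 / t" using t_pos by (simp add: add_pos_pos)
  then have L: "0 < L"
    unfolding L_def using k_gt_1 by (intro mult_pos_pos) auto
  show ?thesis
  proof (intro exI[of _ \<epsilon>\<^sub>0] exI[of _ "\<lambda>\<epsilon>. L * \<epsilon>"] conjI ballI allI impI)
    show "0 < \<epsilon>\<^sub>0" by (rule eps0)
    show "0 < L * \<epsilon>" if "\<epsilon> \<in> {0<..<\<epsilon>\<^sub>0}" for \<epsilon>
      using that L by simp
    show "((\<lambda>\<epsilon>. L * \<epsilon>) \<longlongrightarrow> 0) (at 0 within {0<..<\<epsilon>\<^sub>0})"
      by (auto intro!: tendsto_eq_intros)
    fix \<epsilon> :: real and x :: "nat \<Rightarrow> complex"
    assume eps: "\<epsilon> \<in> {0<..<\<epsilon>\<^sub>0}"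
    assume x: "Some (x 0) \<notin> avoided_g \<alpha> \<beta> k \<delta> \<and>
      (\<forall>i. \<exists>w. moebius a b c d (Some (x i)) = Some w \<and> cmod (x (Suc i) - w) \<le> \<epsilon>)"
    have err: "cmod (x (Suc i) - g (x i)) \<le> \<epsilon>" for i
      using x by (auto simp: moebius_def split: if_splits)
    have small: "\<epsilon> * ((1 + k * t) * (1 + t)) \<le> (k - 1) * t * cmod (\<alpha> - \<beta>)"
      using eps denom by (simp add: \<epsilon>\<^sub>0_def pos_less_divide_eq)
    have safe: "x i \<in> safe" for i
    proof (induction i)
      case 0
      show ?case using x by (intro start_in_safe[OF t_def]) simp
    next
      case (Suc i)
      show ?case by (rule perturbed_image_in_safe[OF Suc err small])
    qed
    show "\<exists>y :: nat \<Rightarrow> complex.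
        (\<forall>i. moebius a b c d (Some (y i)) = Some (y (Suc i))) \<and> (\<forall>i. cmod (x i - y i) \<le> L * \<epsilon>)"
    proof (intro exI[of _ "\<lambda>n. (g ^^ n) (x 0)"] conjI allI)
      show "moebius a b c d (Some ((g ^^ i) (x 0))) = Some ((g ^^ Suc i) (x 0))" for i
        using safe_moebius[OF iterate_in_safe[OF safe]] by simp
      show "cmod (x i - (g ^^ i) (x 0)) \<le> L * \<epsilon>" for i
        unfolding L_def using safe err by (rule pseudo_orbit_shadowed)
    qed
  qed
qed

end
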